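(* Let $m,n\ge 1$ and $b\in[-1,1]^m$. Let $q^*$ and $q_*$ be the supervertex and subvertex of $P(b)$ and set $\Gamma=\Gamma(\mathcal L^n,b)$. Let $F:\mathcal L^n\to\mathbb R$ be a truncated $\ell$-positive function. Then for any $P\in\Gamma$, any $0\le k\le n$ and any $\omega\in\mathcal L^{n-k}$ such that $P(A_\omega)>0$, $$E_P(F\mid A_\omega)\le E_{q^*}(F_{\omega-}).$$ In particular $F_{\max}(\Gamma)=E_{q^*}(F)$. The condition $q_*\in P(b)$ is equivalent to $\frac1m\sum_{i=1}^m b(i)\le \frac2m-1$. If $q_*\in P(b)$, then for any such $P$, $k$, $\omega$, $$E_P(F\mid A_\omega)\ge E_{q_*}(F_{\omega-}).$$ In particular, in this case, $F_{\min}(\Gamma)=E_{q_*}(F)$.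
   Context: Fix an integer $m\ge1$. $\mathcal L$ is the set of all functions $\lambda:\{1,\dots,m\}\to\{0,1\}$, with the convention $\lambda(0)=0$. $\mathbb R^{\mathcal L}$ is the space of functions $\mathcal L\to\mathbb R$ with standard basis $\{e_\lambda\}$ and standard inner product $\langle\ ,\ \rangle$. For $0\le i\le m$ let $\ell_i(\lambda)=(-1)^{\lambda(i)}$ (so $\ell_0$ is constant $1$). For $b\in\mathbb R^m$, $P(b)=\{x\in\mathbb R^{\mathcal L}: x(\lambda)\ge 0\ \forall\lambda,\ \langle \ell_0,x\rangle=1,\ \langle \ell_i,x\rangle=b(i)\text{ for }1\le i\le m\}$; its elements are probability density functions on $\mathcal L$. Truncation: $t^+=\max\{t,0\}$ for $t\in\mathbb R$, and $v^+(\lambda)=v(\lambda)^+$ for $v\in\mathbb R^{\mathcal L}$. $U_{\ell\text{-pos}}$ is the set of vectors $\sum_{i=0}^m a_i\ell_i$ with $a_1,\dots,a_m>0$ ($a_0\in\mathbb R$ arbitrary), and $(U_{\ell\text{-pos}})^+=\{\sum_{i=1}^k u_i^+ : u_i\in U_{\ell\text{-pos}},\ k\ge0\}$. Elements of $\mathcal L^k$ are regarded as words of length $k$ in the alphabet $\mathcal L$; juxtaposition is concatenation. $F:\mathcal L^n\to\mathbb R$ is truncated $\ell$-positive if for all words $\omega,\tau$ of total length $n-1$ the function $\lambda\mapsto F(\omega\lambda\tau)$ belongs to $(U_{\ell\text{-pos}})^+$. For $\omega\in\mathcal L^{n-k}$: $A_\omega=\{\omega\tau:\tau\in\mathcal L^k\}\subseteq\mathcal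 L^n$ and $F_{\omega-}:\mathcal L^k\to\mathbb R$, $F_{\omega-}(\tau)=F(\omega\tau)$. Let $\mathcal T^*$ be the set of words of length $<n$ in $\mathcal L$. For $\Phi:\mathcal T^*\to P(b)$ let $P(\Phi)$ be the probability density on $\mathcal L^n$ given by $P(\Phi)(\lambda_1\cdots\lambda_n)=\prod_{k=1}^n\Phi(\lambda_1\cdots\lambda_{k-1})(\lambda_k)$, and $\Gamma(\mathcal L^n,b)=\{P(\Phi):\Phi:\mathcal T^*\to P(b)\}$. $F_{\max}(\Gamma)$ and $F_{\min}(\Gamma)$ denote the maximum and minimum of $E_P(F)$ over $P\in\Gamma$. For a density $p$ on $\mathcal L$, $E_p$ of a function on $\mathcal L^k$ is the expectation with respect to the product measure $p^{\otimes k}$ on $\mathcal L^k$. Supervertex $q^*$ (for $b\in[-1,1]^m$): put $b(0)=1$, $b(m+1)=-1$. If $b(1)\ge\dots\ge b(m)$, set $b'(i)=\frac{b(i)-b(i+1)}2$ for $0\le i\le m$, let $\mu_i\in\mathcal L$ be $\mu_i(k)=0$ if $k\le i$ and $\mu_i(k)=1$ if $k\ge i+1$, and let $q^*=\sum_{i=0}^m b'(i)e_{\mu_i}$. For general $b$, choose a permutation $\sigma$ of $\{1,\dots,m\}$ with $b\circ\sigma^{-1}$ decreasing; $q^*$ is the vector for which $\lambda\mapsto q^*(\lambda\circ\sigma)$ is the supervertex of $P(b\circ\sigma^{-1})$ (independent of the choice of $\sigma$). The supervertex belongs to $P(b)$. Subvertex $q_*$ (for $b\in[-1,1]^m$): $\nu_i\in\mathcal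 L$, $0\le i\le m$, is $\nu_i(j)=1-\delta_{ij}$ for $1\le j\le m$; $b''(i)=\frac{b(i)+1}{2}$ for $1\le i\le m$, $b''(0)=1-\sum_{i=1}^m b''(i)$; and $q_*=\sum_{i=0}^m b''(i)e_{\nu_i}\in\mathbb R^{\mathcal L}$ (in general $q_*$ need not lie in $P(b)$). *)

theory Defs
  imports Complex_Main "HOL-Combinatorics.Permutations"
begin

text \<open>
  A function \<open>{1..m} \<rightarrow> {0,1}\<close> is represented by its extension by zero to all of \<open>nat\<close>; this
  builds in the convention \<open>\<lambda>(0) = 0\<close>.

  Real functions on \<open>\<L> = letters m\<close> and on \<open>\<L>\<^sup>n = words m n\<close> are represented by functions on the
  ambient types \<open>letter\<close> and \<open>letter list\<close>.  Only their values on \<open>letters m\<close>, respectively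
  \<open>words m n\<close>, matter: every set of functions below is closed under changing values elsewhere.
  Likewise \<open>b \<in> \<real>\<^sup>m\<close> is a function \<open>nat \<Rightarrow> real\<close> of which only the values on \<open>{1..m}\<close> are used.
\<close>

type_synonym letter = "nat \<Rightarrow> nat"

definition letters :: "nat \<Rightarrow> letter set" where
  "letters m = {x. (\<forall>i\<in>{1..m}. x i \<in> {0, 1}) \<and> (\<forall>i. i \<notin> {1..m} \<longrightarrow> x i = 0)}"

definition words :: "nat \<Rightarrow> nat \<Rightarrow> letter list set" where
  "words m n = {w. set w \<subseteq> letters m \<and> length w = n}"

definition ell :: "nat \<Rightarrow> letter \<Rightarrow> real" where
  "ell i x = (-1) ^ x i"

definition inner_L :: "nat \<Rightarrow> (letter \<Rightarrow> real) \<Rightarrow> (letter \<Rightarrow> real) \<Rightarrow> real" where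
  "inner_L m u v = (\<Sum>x\<in>letters m. u x * v x)"

definition Pb :: "nat \<Rightarrow> (nat \<Rightarrow> real) \<Rightarrow> (letter \<Rightarrow> real) set" where
  "Pb m b = {p. (\<forall>x\<in>letters m. 0 \<le> p x) \<and> inner_L m (ell 0) p = 1 \<and>
                (\<forall>i\<in>{1..m}. inner_L m (ell i) p = b i)}"

definition U_lpos :: "nat \<Rightarrow> (letter \<Rightarrow> real) set" where
  "U_lpos m = {u. \<exists>a :: nat \<Rightarrow> real. (\<forall>i\<in>{1..m}. 0 < a i) \<and>
                  (\<forall>x\<in>letters m. u x = (\<Sum>i=0..m. a i * ell i x))}"

definition trunc :: "(letter \<Rightarrow> real) \<Rightarrow> letter \<Rightarrow> real" where
  "trunc v x = max (v x) 0"

definition U_lpos_plus :: "nat \<Rightarrow> (letter \<Rightarrow> real) set" where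
  "U_lpos_plus m = {f. \<exists>us. set us \<subseteq> U_lpos m \<and>
                       (\<forall>x\<in>letters m. f x = (\<Sum>u\<leftarrow>us. trunc u x))}"

definition truncated_lpos :: "nat \<Rightarrow> nat \<Rightarrow> (letter list \<Rightarrow> real) \<Rightarrow> bool" where
  "truncated_lpos m n F \<longleftrightarrow>
     (\<forall>w t. set w \<subseteq> letters m \<and> set t \<subseteq> letters m \<and> length w + length t + 1 = n \<longrightarrow>
            (\<lambda>x. F (w @ [x] @ t)) \<in> U_lpos_plus m)"

definition cylinder :: "nat \<Rightarrow> nat \<Rightarrow> letter list \<Rightarrow> letter list set" where
  "cylinder m k w = {w @ t | t. t \<in> words m k}"

definition after :: "(letter list \<Rightarrow> real) \<Rightarrow> letter list \<Rightarrow> letter list \<Rightarrow> real" where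
  "after F w t = F (w @ t)"

definition prob_of :: "(letter list \<Rightarrow> real) \<Rightarrow> letter list set \<Rightarrow> real" where
  "prob_of P A = (\<Sum>w\<in>A. P w)"

definition expect :: "nat \<Rightarrow> nat \<Rightarrow> (letter list \<Rightarrow> real) \<Rightarrow> (letter list \<Rightarrow> real) \<Rightarrow> real" where
  "expect m n P F = (\<Sum>w\<in>words m n. P w * F w)"

definition cond_expect ::
  "(letter list \<Rightarrow> real) \<Rightarrow> (letter list \<Rightarrow> real) \<Rightarrow> letter list set \<Rightarrow> real" where
  "cond_expect P F A = (\<Sum>w\<in>A. P w * F w) / prob_of P A"

definition product_density :: "(letter \<Rightarrow> real) \<Rightarrow> letter list \<Rightarrow> real" where
  "product_density p w = (\<Prod>x\<leftarrow>w. p x)"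

definition expect_iid :: "nat \<Rightarrow> nat \<Rightarrow> (letter \<Rightarrow> real) \<Rightarrow> (letter list \<Rightarrow> real) \<Rightarrow> real" where
  "expect_iid m k p G = expect m k (product_density p) G"

definition tree_density :: "nat \<Rightarrow> (letter list \<Rightarrow> letter \<Rightarrow> real) \<Rightarrow> letter list \<Rightarrow> real" where
  "tree_density n \<Phi> w = (\<Prod>k=1..n. \<Phi> (take (k - 1) w) (w ! (k - 1)))"

definition Gam :: "nat \<Rightarrow> nat \<Rightarrow> (nat \<Rightarrow> real) \<Rightarrow> (letter list \<Rightarrow> real) set" where
  "Gam m n b = {P. \<exists>\<Phi>. (\<forall>j<n. \<forall>w\<in>words m j. \<Phi> w \<in> Pb m b) \<and>
                        (\<forall>w\<in>words m n. P w = tree_density n \<Phi> w)}"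

definition is_maximum :: "real \<Rightarrow> real set \<Rightarrow> bool" where
  "is_maximum t S \<longleftrightarrow> t \<in> S \<and> (\<forall>s\<in>S. s \<le> t)"

definition is_minimum :: "real \<Rightarrow> real set \<Rightarrow> bool" where
  "is_minimum t S \<longleftrightarrow> t \<in> S \<and> (\<forall>s\<in>S. t \<le> s)"

definition basis_vec :: "letter \<Rightarrow> letter \<Rightarrow> real" where
  "basis_vec y x = (if x = y then 1 else 0)"

definition b_ext :: "nat \<Rightarrow> (nat \<Rightarrow> real) \<Rightarrow> nat \<Rightarrow> real" where
  "b_ext m b i = (if i = 0 then 1 else if i = m + 1 then -1 else b i)"

definition mu :: "nat \<Rightarrow> nat \<Rightarrow> letter" where
  "mu m i k = (if k \<in> {1..m} \<and> i + 1 \<le> k then 1 else 0)"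

text \<open>The formula for the supervertex when \<open>b\<close> is decreasing on \<open>{1..m}\<close>.\<close>

definition supervertex_decr :: "nat \<Rightarrow> (nat \<Rightarrow> real) \<Rightarrow> letter \<Rightarrow> real" where
  "supervertex_decr m b x =
     (\<Sum>i=0..m. (b_ext m b i - b_ext m b (i + 1)) / 2 * basis_vec (mu m i) x)"

definition sorting_perm :: "nat \<Rightarrow> (nat \<Rightarrow> real) \<Rightarrow> (nat \<Rightarrow> nat) \<Rightarrow> bool" where
  "sorting_perm m b \<sigma> \<longleftrightarrow> \<sigma> permutes {1..m} \<and>
     (\<forall>i\<in>{1..m}. \<forall>j\<in>{1..m}. i \<le> j \<longrightarrow> (b \<circ> inv \<sigma>) j \<le> (b \<circ> inv \<sigma>) i)"

text \<open>
  The requirement that \<open>\<lambda> \<mapsto> q(\<lambda> \<circ> \<sigma>)\<close> be the supervertex for \<open>b \<circ> \<sigma>\<^sup>-\<^sup>1\<close> is solved for \<open>q\<close>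
  by substituting \<open>\<lambda> = x \<circ> \<sigma>\<^sup>-\<^sup>1\<close>.
\<close>

definition supervertex :: "nat \<Rightarrow> (nat \<Rightarrow> real) \<Rightarrow> letter \<Rightarrow> real" where
  "supervertex m b =
     (let \<sigma> = (SOME \<sigma>. sorting_perm m b \<sigma>)
      in (\<lambda>x. supervertex_decr m (b \<circ> inv \<sigma>) (x \<circ> inv \<sigma>)))"

definition nu :: "nat \<Rightarrow> nat \<Rightarrow> letter" where
  "nu m i j = (if j \<in> {1..m} \<and> j \<noteq> i then 1 else 0)"

definition b_sub :: "nat \<Rightarrow> (nat \<Rightarrow> real) \<Rightarrow> nat \<Rightarrow> real" where
  "b_sub m b i = (if i = 0 then 1 - (\<Sum>j=1..m. (b j + 1) / 2) else (b i + 1) / 2)"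

definition subvertex :: "nat \<Rightarrow> (nat \<Rightarrow> real) \<Rightarrow> letter \<Rightarrow> real" where
  "subvertex m b x = (\<Sum>i=0..m. b_sub m b i * basis_vec (nu m i) x)"

end

theory Submission
  imports Defs
begin

text \<open>
  Encode a letter \<open>x\<close> by the set of coordinates where it vanishes.  Truncations of
  \<open>\<ell>\<close>-positive vectors are then convex functions of a positive additive set function, hence
  supermodular.  For a supermodular \<open>f\<close>, the function affine in \<open>\<ell>\<^sub>1, \<dots>, \<ell>\<^sub>m\<close> that agrees with
  \<open>f\<close> on a maximal chain dominates \<open>f\<close>, and the one that agrees with \<open>f\<close> on the empty set and the
  singletons is dominated by \<open>f\<close>.  All elements of \<open>P(b)\<close> give an affine function the same
  expectation, and the super- and subvertex are supported on such a chain and on those sets,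
  so they are extremal for a single letter.  Replacing the transition densities of a tree by the
  extremal one, from the last letter backwards, gives the result for words.
\<close>

section \<open>Letters, words and densities on trees\<close>

lemma finite_letters: "finite (letters m)"
proof -
  have "letters m = {x. \<forall>i. (i \<in> {1..m} \<longrightarrow> x i \<in> {0, 1}) \<and> (i \<notin> {1..m} \<longrightarrow> x i = 0)}"
    unfolding letters_def by blast
  then show ?thesis
    by (simp only:) (rule finite_set_of_finite_funs, auto)
qed

lemma sum_words_0: "(\<Sum>t\<in>words m 0. g t) = g []"
proof -
  have "words m 0 = {[]}" by (auto simp: words_def)
  then show ?thesis by simp
qed

lemma sum_words_Suc:
  "(\<Sum>t\<in>words m (Suc k). g t) = (\<Sum>x\<in>letters m. \<Sum>t\<in>words m k. g (x # t))"
proof -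
  have eq: "words m (Suc k) = (\<lambda>(x, t). x # t) ` (letters m \<times> words m k)"
    by (auto simp: words_def image_iff length_Suc_conv)
  have "inj_on (\<lambda>(x, t). x # t) (letters m \<times> words m k)"
    by (auto simp: inj_on_def)
  then show ?thesis
    by (simp add: eq sum.reindex sum.cartesian_product case_prod_unfold)
qed

text \<open>The probability of continuing with \<open>t\<close> once the prefix \<open>w\<close> has
  been reached. Recursion on the remaining word, with the history as a parameter, suits conditioning
  on a prefix.\<close>

fun path_density :: "(letter list \<Rightarrow> letter \<Rightarrow> real) \<Rightarrow> letter list \<Rightarrow> letter list \<Rightarrow> real" where
  "path_density \<Phi> w [] = 1"
| "path_density \<Phi> w (x # t) = \<Phi> w x * path_density \<Phi> (w @ [x]) t"

lemma path_density_append: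
  "path_density \<Phi> v (w @ t) = path_density \<Phi> v w * path_density \<Phi> (v @ w) t"
  by (induction w arbitrary: v) auto

lemma path_density_const: "path_density (\<lambda>_. q) w t = product_density q t"
  by (induction t arbitrary: w) (auto simp: product_density_def)

lemma path_density_eq_prod:
  "path_density \<Phi> w t = (\<Prod>k<length t. \<Phi> (w @ take k t) (t ! k))"
proof (induction t arbitrary: w)
  case (Cons x t)
  show ?case
    using Cons[of "w @ [x]"] by (simp add: prod.lessThan_Suc_shift del: prod.lessThan_Suc)
qed simp

lemma tree_density_eq_path_density:
  assumes "length w = n"
  shows "tree_density n \<Phi> w = path_density \<Phi> [] w"
proof -
  have "(\<Prod>k=1..n. \<Phi> (take (k - 1) w) (w ! (k - 1))) = (\<Prod>k<n. \<Phi> (take k w) (w ! k))"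
    by (rule prod.reindex_bij_witness[of _ Suc "\<lambda>k. k - 1"]) auto
  then show ?thesis
    using assms by (simp add: tree_density_def path_density_eq_prod)
qed

definition density_tree ::
  "nat \<Rightarrow> nat \<Rightarrow> (nat \<Rightarrow> real) \<Rightarrow> (letter list \<Rightarrow> letter \<Rightarrow> real) \<Rightarrow> bool" where
  "density_tree m n b \<Phi> \<longleftrightarrow> (\<forall>j<n. \<forall>w\<in>words m j. \<Phi> w \<in> Pb m b)"

lemma density_treeD:
  assumes "density_tree m n b \<Phi>" "set w \<subseteq> letters m" "length w < n"
  shows "\<Phi> w \<in> Pb m b"
  using assms by (auto simp: density_tree_def words_def)

lemma Pb_nonneg: "p \<in> Pb m b \<Longrightarrow> x \<in> letters m \<Longrightarrow> 0 \<le> p x"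
  by (auto simp: Pb_def)

lemma Pb_sum_eq_1:
  assumes p: "p \<in> Pb m b"
  shows "(\<Sum>x\<in>letters m. p x) = 1"
proof -
  have "(\<Sum>x\<in>letters m. p x) = inner_L m (ell 0) p"
    unfolding inner_L_def by (rule sum.cong) (auto simp: ell_def letters_def)
  then show ?thesis using p by (simp add: Pb_def)
qed

lemma Pb_sum_ell: "p \<in> Pb m b \<Longrightarrow> i \<in> {1..m} \<Longrightarrow> (\<Sum>x\<in>letters m. p x * ell i x) = b i"
  by (auto simp: Pb_def inner_L_def mult.commute)

text \<open>Serves to identify the mass of a cylinder with the density of its prefix: whatever the
  prefix, the letters still to come carry total mass 1.\<close>

lemma sum_path_density:
  assumes "density_tree m n b \<Phi>"
  shows "set w \<subseteq> letters m \<Longrightarrow> length w + k \<le> n \<Longrightarrow> (\<Sum>t\<in>words m k. path_density \<Phi> w t) = 1"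
proof (induction k arbitrary: w)
  case (Suc k)
  have "(\<Sum>t\<in>words m (Suc k). path_density \<Phi> w t)
      = (\<Sum>x\<in>letters m. \<Phi> w x * (\<Sum>t\<in>words m k. path_density \<Phi> (w @ [x]) t))"
    by (simp add: sum_words_Suc sum_distrib_left)
  also have "\<dots> = (\<Sum>x\<in>letters m. \<Phi> w x)"
    using Suc by (intro sum.cong) auto
  also have "\<dots> = 1"
    using Suc.prems density_treeD[OF assms, of w] by (intro Pb_sum_eq_1) auto
  finally show ?case .
qed (simp add: sum_words_0)

text \<open>One-letter optimality of \<open>q\<close> against \<open>P(b)\<close>. Here
  \<open>q\<close> ranges over all functions, so the subvertex can be compared with
  \<open>P(b)\<close> before its membership is decided.\<close>

definition dominates ::
  "nat \<Rightarrow> (nat \<Rightarrow> real) \<Rightarrow> (letter \<Rightarrow> real) \<Rightarrow> (letter \<Rightarrow> real) \<Rightarrow> bool" where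
  "dominates m b q f \<longleftrightarrow>
     (\<forall>p\<in>Pb m b. (\<Sum>x\<in>letters m. p x * f x) \<le> (\<Sum>x\<in>letters m. q x * f x))"

lemma product_density_nonneg:
  assumes "\<And>x. x \<in> letters m \<Longrightarrow> 0 \<le> q x" "set t \<subseteq> letters m"
  shows "0 \<le> product_density q t"
  using assms(2) by (induction t) (auto simp: product_density_def assms(1))

text \<open>Induction on the number of letters left. The hypothesis, applied after the next letter,
  turns the tail into independent letters of density \<open>q\<close>; then the next letter is
  optimised for each fixed tail. Both replacements carry nonnegative weights,
  \<open>\<Phi> w x\<close> and \<open>product_density q t\<close>.\<close>

lemma path_expect_le_iid:
  assumes tree: "density_tree m n b \<Phi>"
    and q: "\<And>x. x \<in> letters m \<Longrightarrow> 0 \<le> q x"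
    and dom: "\<And>w t. set w \<subseteq> letters m \<Longrightarrow> set t \<subseteq> letters m \<Longrightarrow> length w + length t + 1 = n \<Longrightarrow>
                dominates m b q (\<lambda>x. F (w @ [x] @ t))"
  shows "set w \<subseteq> letters m \<Longrightarrow> length w + k = n \<Longrightarrow>
    (\<Sum>t\<in>words m k. path_density \<Phi> w t * F (w @ t))
      \<le> (\<Sum>t\<in>words m k. product_density q t * F (w @ t))"
proof (induction k arbitrary: w)
  case (Suc k)
  have p: "\<Phi> w \<in> Pb m b"
    using Suc.prems by (intro density_treeD[OF tree]) auto
  have "(\<Sum>t\<in>words m (Suc k). path_density \<Phi> w t * F (w @ t))
      = (\<Sum>x\<in>letters m. \<Phi> w x *
          (\<Sum>t\<in>words m k. path_density \<Phi> (w @ [x]) t * F ((w @ [x]) @ t)))"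
    by (simp add: sum_words_Suc sum_distrib_left mult.assoc)
  also have "\<dots> \<le> (\<Sum>x\<in>letters m. \<Phi> w x *
          (\<Sum>t\<in>words m k. product_density q t * F ((w @ [x]) @ t)))"
    using Suc.prems by (intro sum_mono mult_left_mono Suc.IH Pb_nonneg[OF p]) auto
  \<comment> \<open>The weight of the tail is now free of \<open>x\<close>, so the sums can be
    interchanged.\<close>
  also have "\<dots> = (\<Sum>t\<in>words m k. product_density q t *
          (\<Sum>x\<in>letters m. \<Phi> w x * F (w @ [x] @ t)))"
    unfolding sum_distrib_left by (subst sum.swap) (simp add: algebra_simps)
  also have "\<dots> \<le> (\<Sum>t\<in>words m k. product_density q t *
          (\<Sum>x\<in>letters m. q x * F (w @ [x] @ t)))"
  proof (rule sum_mono, rule mult_left_mono)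
    fix t assume t: "t \<in> words m k"
    then show "0 \<le> product_density q t"
      using product_density_nonneg[of m q t] q by (auto simp: words_def)
    show "(\<Sum>x\<in>letters m. \<Phi> w x * F (w @ [x] @ t)) \<le> (\<Sum>x\<in>letters m. q x * F (w @ [x] @ t))"
      using dom[of w t] t p Suc.prems by (auto simp: dominates_def words_def)
  qed
  also have "\<dots> = (\<Sum>t\<in>words m (Suc k). product_density q t * F (w @ t))"
    unfolding sum_words_Suc sum_distrib_left
    by (subst sum.swap) (simp add: algebra_simps product_density_def)
  finally show ?case .
qed (simp add: sum_words_0 product_density_def)

lemma Gam_obtain:
  assumes "P \<in> Gam m n b"
  obtains \<Phi> where "density_tree m n b \<Phi>"
    "\<And>w. w \<in> words m n \<Longrightarrow> P w = path_density \<Phi> [] w"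
proof -
  from assms obtain \<Phi> where "density_tree m n b \<Phi>"
    "\<forall>w\<in>words m n. P w = tree_density n \<Phi> w"
    unfolding Gam_def density_tree_def by blast
  then show ?thesis
    by (intro that[of \<Phi>]) (auto simp: words_def tree_density_eq_path_density)
qed

lemma sum_cylinder: "(\<Sum>v\<in>cylinder m k w. g v) = (\<Sum>t\<in>words m k. g (w @ t))"
proof -
  have "cylinder m k w = (\<lambda>t. w @ t) ` words m k"
    by (auto simp: cylinder_def)
  then show ?thesis by (simp add: sum.reindex inj_on_def)
qed

text \<open>On a cylinder the density factors into the density \<open>D\<close> of the prefix times
  the path density of the continuation. The factor \<open>D\<close> cancels in the quotient, leaving
  an expectation over paths that start at \<open>w\<close>.\<close>

lemma cond_expect_le_iid:
  assumes P: "P \<in> Gam m n b"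
    and q: "\<And>x. x \<in> letters m \<Longrightarrow> 0 \<le> q x"
    and dom: "\<And>w t. set w \<subseteq> letters m \<Longrightarrow> set t \<subseteq> letters m \<Longrightarrow> length w + length t + 1 = n \<Longrightarrow>
                dominates m b q (\<lambda>x. F (w @ [x] @ t))"
    and k: "k \<le> n" and w: "w \<in> words m (n - k)"
    and pos: "0 < prob_of P (cylinder m k w)"
  shows "cond_expect P F (cylinder m k w) \<le> expect_iid m k q (after F w)"
proof -
  obtain \<Phi> where tree: "density_tree m n b \<Phi>"
    and P_eq: "\<And>w. w \<in> words m n \<Longrightarrow> P w = path_density \<Phi> [] w"
    using Gam_obtain[OF P] by blast
  define D where "D = path_density \<Phi> [] w"
  have P_app: "P (w @ t) = D * path_density \<Phi> w t" if "t \<in> words m k" for t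
    using that w k P_eq[of "w @ t"] by (auto simp: words_def D_def path_density_append)
  have "prob_of P (cylinder m k w) = D * (\<Sum>t\<in>words m k. path_density \<Phi> w t)"
    unfolding prob_of_def sum_cylinder sum_distrib_left by (rule sum.cong) (auto simp: P_app)
  also have "\<dots> = D"
    using w k by (subst sum_path_density[OF tree]) (auto simp: words_def)
  finally have prob: "prob_of P (cylinder m k w) = D" .
  have "(\<Sum>v\<in>cylinder m k w. P v * F v) = D * (\<Sum>t\<in>words m k. path_density \<Phi> w t * F (w @ t))"
    unfolding sum_cylinder sum_distrib_left by (rule sum.cong) (auto simp: P_app)
  then have "cond_expect P F (cylinder m k w) = (\<Sum>t\<in>words m k. path_density \<Phi> w t * F (w @ t))"
    using pos unfolding cond_expect_def prob by simp
  also have "\<dots> \<le> (\<Sum>t\<in>words m k. product_density q t * F (w @ t))"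
    using w k by (intro path_expect_le_iid[OF tree q dom]) (auto simp: words_def)
  finally show ?thesis
    by (simp add: expect_iid_def expect_def after_def)
qed

text \<open>Attained at the constant tree \<open>\<lambda>_. q\<close>, whose density is the product
  density; the bound is the case of the empty prefix.\<close>

lemma is_maximum_expect_iid:
  assumes q: "q \<in> Pb m b"
    and dom: "\<And>w t. set w \<subseteq> letters m \<Longrightarrow> set t \<subseteq> letters m \<Longrightarrow> length w + length t + 1 = n \<Longrightarrow>
                dominates m b q (\<lambda>x. F (w @ [x] @ t))"
  shows "is_maximum (expect_iid m n q F) ((\<lambda>P. expect m n P F) ` Gam m n b)"
  unfolding is_maximum_def
proof (intro conjI ballI)
  have "product_density q \<in> Gam m n b"
    unfolding Gam_def
  proof (intro CollectI exI conjI)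
    show "\<forall>j<n. \<forall>w\<in>words m j. (\<lambda>_. q) w \<in> Pb m b"
      using q by simp
    show "\<forall>w\<in>words m n. product_density q w = tree_density n (\<lambda>_. q) w"
      by (auto simp: words_def tree_density_eq_path_density path_density_const)
  qed
  then show "expect_iid m n q F \<in> (\<lambda>P. expect m n P F) ` Gam m n b"
    by (auto simp: expect_iid_def)
next
  fix s assume "s \<in> (\<lambda>P. expect m n P F) ` Gam m n b"
  then obtain P where P: "P \<in> Gam m n b" and s: "s = expect m n P F" by blast
  obtain \<Phi> where tree: "density_tree m n b \<Phi>"
    and P_eq: "\<And>w. w \<in> words m n \<Longrightarrow> P w = path_density \<Phi> [] w"
    using Gam_obtain[OF P] by blast
  have "s = (\<Sum>t\<in>words m n. path_density \<Phi> [] t * F ([] @ t))"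
    unfolding s expect_def by (rule sum.cong) (auto simp: P_eq)
  also have "\<dots> \<le> (\<Sum>t\<in>words m n. product_density q t * F ([] @ t))"
    by (intro path_expect_le_iid[OF tree Pb_nonneg[OF q] dom]) auto
  finally show "s \<le> expect_iid m n q F"
    by (simp add: expect_iid_def expect_def)
qed

section \<open>Sign change between maxima and minima\<close>

lemma cond_expect_uminus: "cond_expect P (\<lambda>w. - F w) A = - cond_expect P F A"
  by (simp add: cond_expect_def sum_negf)

lemma expect_uminus: "expect m n P (\<lambda>w. - F w) = - expect m n P F"
  by (simp add: expect_def sum_negf)

lemma expect_iid_uminus: "expect_iid m n q (\<lambda>w. - F w) = - expect_iid m n q F"
  by (simp add: expect_iid_def expect_uminus)

lemma is_maximum_uminus: "is_maximum (- t) ((\<lambda>x. - f x) ` S) \<longleftrightarrow> is_minimum t (f ` S)"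
  by (auto simp: is_maximum_def is_minimum_def)

section \<open>Supermodular functions of a letter\<close>

text \<open>
  A larger letter vanishes on fewer coordinates, so supermodularity in terms of
  zero sets reads as follows.
\<close>

definition supermodular :: "nat \<Rightarrow> (letter \<Rightarrow> real) \<Rightarrow> bool" where
  "supermodular m f \<longleftrightarrow> (\<forall>y\<in>letters m. \<forall>z\<in>letters m. \<forall>i\<in>{1..m}. (\<forall>j. z j \<le> y j) \<longrightarrow>
     f (y(i := 0)) - f (y(i := 1)) \<le> f (z(i := 0)) - f (z(i := 1)))"

lemma letters_upd: "y \<in> letters m \<Longrightarrow> i \<in> {1..m} \<Longrightarrow> c \<in> {0, 1} \<Longrightarrow> y(i := c) \<in> letters m"
  by (auto simp: letters_def)

lemma letters_cases: "x \<in> letters m \<Longrightarrow> x i = 0 \<or> x i = 1"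
  by (cases "i \<in> {1..m}") (auto simp: letters_def)

lemma ell_antimono:
  assumes "y \<in> letters m" "z \<in> letters m" "z i \<le> y i"
  shows "ell i y \<le> ell i z"
  using letters_cases[OF assms(1), of i] letters_cases[OF assms(2), of i] assms(3)
  by (auto simp: ell_def)

text \<open>Write \<open>s\<close> for the contribution of the coordinates other than
  \<open>i\<close>. The gain from clearing coordinate \<open>i\<close> is
  \<open>max (s + a i) 0 - max (s - a i) 0\<close>, nondecreasing in \<open>s\<close> because
  truncation is convex and \<open>a i > 0\<close>; and \<open>s\<close> does not decrease when the
  letter gets smaller.\<close>

lemma supermodular_trunc:
  assumes "u \<in> U_lpos m"
  shows "supermodular m (trunc u)"
  unfolding supermodular_def
proof (intro ballI impI)
  fix y z i
  assume y: "y \<in> letters m" and z: "z \<in> letters m" and i: "i \<in> {1..m}" and le: "\<forall>j. z j \<le> y j"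
  obtain a where a: "\<And>i. i \<in> {1..m} \<Longrightarrow> 0 < a i"
    and u: "\<And>x. x \<in> letters m \<Longrightarrow> u x = (\<Sum>i=0..m. a i * ell i x)"
    using assms unfolding U_lpos_def by blast
  have upd: "u (x(i := c)) = a i * (-1) ^ c + (\<Sum>j\<in>{0..m} - {i}. a j * ell j x)"
    if "x \<in> letters m" "c \<in> {0, 1}" for x c
  proof -
    have "u (x(i := c)) = (\<Sum>j=0..m. a j * ell j (x(i := c)))"
      using letters_upd[OF that(1) i that(2)] by (rule u)
    also have "\<dots> = a i * ell i (x(i := c)) + (\<Sum>j\<in>{0..m} - {i}. a j * ell j (x(i := c)))"
      using i by (intro sum.remove) auto
    also have "(\<Sum>j\<in>{0..m} - {i}. a j * ell j (x(i := c))) = (\<Sum>j\<in>{0..m} - {i}. a j * ell j x)"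
      by (rule sum.cong) (auto simp: ell_def)
    also have "ell i (x(i := c)) = (-1) ^ c"
      by (simp add: ell_def)
    finally show ?thesis .
  qed
  have "(\<Sum>j\<in>{0..m} - {i}. a j * ell j y) \<le> (\<Sum>j\<in>{0..m} - {i}. a j * ell j z)"
  proof (rule sum_mono)
    fix j assume j: "j \<in> {0..m} - {i}"
    \<comment> \<open>The coefficient \<open>a 0\<close> has arbitrary sign, but
      \<open>ell 0\<close> is constant on letters because they vanish at 0.\<close>
    show "a j * ell j y \<le> a j * ell j z"
    proof (cases "j = 0")
      case True
      then show ?thesis using y z by (simp add: ell_def letters_def)
    next
      case False
      then show ?thesis
        using j a[of j] le ell_antimono[OF y z] by (intro mult_left_mono) auto
    qed
  qed
  then show "trunc u (y(i := 0)) - trunc u (y(i := 1)) \<le> trunc u (z(i := 0)) - trunc u (z(i := 1))"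
    using a[OF i] by (simp add: trunc_def upd y z)
qed

lemma supermodular_sum_list:
  assumes "\<And>u. u \<in> set us \<Longrightarrow> supermodular m (g u)"
  shows "supermodular m (\<lambda>x. \<Sum>u\<leftarrow>us. g u x)"
  using assms
proof (induction us)
  case (Cons u us)
  let ?s = "\<lambda>x. \<Sum>u\<leftarrow>us. g u x"
  have g: "supermodular m (g u)" and s: "supermodular m ?s"
    using Cons by auto
  show ?case
    unfolding supermodular_def
  proof (intro ballI impI)
    fix y z i
    assume *: "y \<in> letters m" "z \<in> letters m" "i \<in> {1..m}" "\<forall>j. z j \<le> y j"
    have "g u (y(i := 0)) - g u (y(i := 1)) \<le> g u (z(i := 0)) - g u (z(i := 1))"
      using g * unfolding supermodular_def by blast
    moreover have "?s (y(i := 0)) - ?s (y(i := 1)) \<le> ?s (z(i := 0)) - ?s (z(i := 1))"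
      using s * unfolding supermodular_def by blast
    ultimately show "(\<Sum>u\<leftarrow>u # us. g u (y(i := 0))) - (\<Sum>u\<leftarrow>u # us. g u (y(i := 1)))
        \<le> (\<Sum>u\<leftarrow>u # us. g u (z(i := 0))) - (\<Sum>u\<leftarrow>u # us. g u (z(i := 1)))"
      by simp
  qed
qed (simp add: supermodular_def)

lemma supermodular_cong:
  assumes "\<And>x. x \<in> letters m \<Longrightarrow> f x = g x"
  shows "supermodular m f = supermodular m g"
  unfolding supermodular_def by (intro ball_cong refl) (simp add: assms letters_upd)

lemma U_lpos_plus_supermodular:
  assumes "f \<in> U_lpos_plus m"
  shows "supermodular m f"
proof -
  obtain us where us: "set us \<subseteq> U_lpos m"
    and f: "\<And>x. x \<in> letters m \<Longrightarrow> f x = (\<Sum>u\<leftarrow>us. trunc u x)"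
    using assms unfolding U_lpos_plus_def by blast
  have "supermodular m (\<lambda>x. \<Sum>u\<leftarrow>us. trunc u x)"
    using us by (intro supermodular_sum_list supermodular_trunc) auto
  then show ?thesis using f by (simp cong: supermodular_cong)
qed

section \<open>Affine bounds for supermodular functions\<close>

lemma mu_letters: "mu m i \<in> letters m"
  by (auto simp: mu_def letters_def)

lemma nu_letters: "nu m i \<in> letters m"
  by (auto simp: nu_def letters_def)

text \<open>On letters, \<open>(1 + ell i x) / 2\<close> is the indicator of \<open>x i = 0\<close>.
  Thus \<open>c\<close> is the value at the letter with all ones, and \<open>d i\<close> is the
  increment for clearing coordinate \<open>i\<close>.\<close>

definition affine_form :: "nat \<Rightarrow> real \<Rightarrow> (nat \<Rightarrow> real) \<Rightarrow> letter \<Rightarrow> real" where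
  "affine_form m c d x = c + (\<Sum>i=1..m. (1 + ell i x) / 2 * d i)"

text \<open>Go from \<open>nu m 0\<close>, whose \<open>m\<close> coordinates are all one, to
  \<open>x\<close> by clearing coordinates in increasing order. By supermodularity, clearing
  \<open>i\<close> on the way gains at least as much as at \<open>nu m 0\<close> and at most as much
  as at the chain element \<open>mu m (i - 1)\<close>.\<close>

lemma supermodular_bounds:
  assumes f: "supermodular m f" and x: "x \<in> letters m"
  shows "f x \<le> affine_form m (f (mu m 0)) (\<lambda>i. f (mu m i) - f (mu m (i - 1))) x"
    and "affine_form m (f (nu m 0)) (\<lambda>i. f (nu m i) - f (nu m 0)) x \<le> f x"
proof -
  \<comment> \<open>\<open>y k\<close> follows \<open>x\<close> up to coordinate \<open>k\<close>
    and has ones on the later coordinates.\<close>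
  define y where "y k = (\<lambda>j. if j \<le> k then x j else nu m 0 j)" for k
  have y_letters: "y k \<in> letters m" for k
    using x nu_letters[of m 0] by (auto simp: y_def letters_def)
  have y0: "y 0 = nu m 0"
    using x by (auto simp: y_def nu_def letters_def fun_eq_iff)
  have ym: "y m = x"
    using x by (auto simp: y_def nu_def letters_def fun_eq_iff)
  have mu0: "mu m 0 = nu m 0"
    by (auto simp: mu_def nu_def fun_eq_iff)
  have step: "(1 + ell i x) / 2 * (f (nu m i) - f (nu m 0)) \<le> f (y i) - f (y (i - 1)) \<and>
      f (y i) - f (y (i - 1)) \<le> (1 + ell i x) / 2 * (f (mu m i) - f (mu m (i - 1)))"
    if i: "i \<in> {1..m}" for i
  proof -
    have y_upd: "(y (i - 1))(i := 1) = y (i - 1)" "y i = (y (i - 1))(i := x i)"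
      using i by (auto simp: y_def nu_def fun_eq_iff)
    have mu_upd: "(mu m (i - 1))(i := 1) = mu m (i - 1)" "(mu m (i - 1))(i := 0) = mu m i"
      using i by (auto simp: mu_def fun_eq_iff)
    have nu_upd: "(nu m 0)(i := 1) = nu m 0" "(nu m 0)(i := 0) = nu m i"
      using i by (auto simp: nu_def fun_eq_iff)
    \<comment> \<open>All three letters have a one at coordinate \<open>i\<close>; before it,
      \<open>mu m (i - 1)\<close> has cleared everything and \<open>nu m 0\<close> nothing, so they
      bracket \<open>y (i - 1)\<close>.\<close>
    have "mu m (i - 1) j \<le> y (i - 1) j" "y (i - 1) j \<le> nu m 0 j" for j
      using x letters_cases[OF x, of j] by (auto simp: mu_def y_def nu_def letters_def)
    then have "f ((nu m 0)(i := 0)) - f ((nu m 0)(i := 1))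
          \<le> f ((y (i - 1))(i := 0)) - f ((y (i - 1))(i := 1))"
      "f ((y (i - 1))(i := 0)) - f ((y (i - 1))(i := 1))
          \<le> f ((mu m (i - 1))(i := 0)) - f ((mu m (i - 1))(i := 1))"
      using f i y_letters mu_letters nu_letters unfolding supermodular_def by blast+
    then have
      "f (nu m i) - f (nu m 0) \<le> f ((y (i - 1))(i := 0)) - f (y (i - 1))"
      "f ((y (i - 1))(i := 0)) - f (y (i - 1)) \<le> f (mu m i) - f (mu m (i - 1))"
      by (simp_all only: y_upd(1) mu_upd nu_upd)
    \<comment> \<open>If \<open>x i = 1\<close>, the path stands still and the factor
      \<open>(1 + ell i x) / 2\<close> is zero; if \<open>x i = 0\<close>, the factor is
      one.\<close>
    then show ?thesis
      using letters_cases[OF x, of i] y_upd by (auto simp: ell_def)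
  qed
  have tele: "f x = f (y 0) + (\<Sum>i=1..m. f (y i) - f (y (i - 1)))"
    using sum_telescope''[of 0 m "\<lambda>i. f (y i)"] ym by (simp add: atLeastSucAtMost_greaterThanAtMost)
  show "f x \<le> affine_form m (f (mu m 0)) (\<lambda>i. f (mu m i) - f (mu m (i - 1))) x"
    unfolding affine_form_def tele y0 mu0 using step by (intro add_left_mono sum_mono) auto
  show "affine_form m (f (nu m 0)) (\<lambda>i. f (nu m i) - f (nu m 0)) x \<le> f x"
    unfolding affine_form_def tele y0 using step by (intro add_left_mono sum_mono) auto
qed

lemma Pb_sum_affine_form:
  assumes p: "p \<in> Pb m b"
  shows "(\<Sum>x\<in>letters m. p x * affine_form m c d x) = c + (\<Sum>i=1..m. (1 + b i) / 2 * d i)"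
proof -
  have "(\<Sum>x\<in>letters m. p x * affine_form m c d x)
      = c * (\<Sum>x\<in>letters m. p x) + (\<Sum>i=1..m. \<Sum>x\<in>letters m. p x * ((1 + ell i x) / 2 * d i))"
    by (subst sum.swap)
       (simp add: affine_form_def distrib_left sum.distrib sum_distrib_left mult.commute)
  also have "(\<Sum>i=1..m. \<Sum>x\<in>letters m. p x * ((1 + ell i x) / 2 * d i))
      = (\<Sum>i=1..m. (1 + b i) / 2 * d i)"
  proof (rule sum.cong)
    fix i assume i: "i \<in> {1..m}"
    have "(\<Sum>x\<in>letters m. p x * ((1 + ell i x) / 2 * d i))
        = ((\<Sum>x\<in>letters m. p x) + (\<Sum>x\<in>letters m. p x * ell i x)) / 2 * d i"
      by (simp add: sum_distrib_left sum_distrib_right sum_divide_distrib flip: sum.distrib)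
         (simp add: field_simps)
    then show "(\<Sum>x\<in>letters m. p x * ((1 + ell i x) / 2 * d i)) = (1 + b i) / 2 * d i"
      using Pb_sum_eq_1[OF p] Pb_sum_ell[OF p i] by simp
  qed simp
  finally show ?thesis using Pb_sum_eq_1[OF p] by simp
qed

lemma sum_basis_vec:
  assumes "\<And>i. i \<in> {0..m} \<Longrightarrow> y i \<in> letters m"
  shows "(\<Sum>x\<in>letters m. (\<Sum>i=0..m. c i * basis_vec (y i) x) * f x) = (\<Sum>i=0..m. c i * f (y i))"
proof -
  have "(\<Sum>x\<in>letters m. (\<Sum>i=0..m. c i * basis_vec (y i) x) * f x)
      = (\<Sum>i=0..m. \<Sum>x\<in>letters m. c i * basis_vec (y i) x * f x)"
    by (subst sum.swap) (simp add: sum_distrib_right)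
  also have "\<dots> = (\<Sum>i=0..m. c i * f (y i))"
  proof (rule sum.cong)
    fix i assume "i \<in> {0..m}"
    have "(\<Sum>x\<in>letters m. c i * basis_vec (y i) x * f x)
        = (\<Sum>x\<in>letters m. if x = y i then c i * f x else 0)"
      by (rule sum.cong) (auto simp: basis_vec_def)
    then show "(\<Sum>x\<in>letters m. c i * basis_vec (y i) x * f x) = c i * f (y i)"
      using assms[OF \<open>i \<in> {0..m}\<close>] by (simp add: finite_letters)
  qed simp
  finally show ?thesis .
qed

section \<open>The subvertex\<close>

text \<open>The mass at index 0 is one minus the other masses, so the terms regroup into increments.
  This is the value in \<open>Pb_sum_affine_form\<close> for the form that agrees with
  \<open>f\<close> at all \<open>nu m i\<close>.\<close>

lemma sum_subvertex:
  "(\<Sum>x\<in>letters m. subvertex m b x * f x)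
    = f (nu m 0) + (\<Sum>i=1..m. (1 + b i) / 2 * (f (nu m i) - f (nu m 0)))"
proof -
  have "(\<Sum>x\<in>letters m. subvertex m b x * f x) = (\<Sum>i=0..m. b_sub m b i * f (nu m i))"
    unfolding subvertex_def by (rule sum_basis_vec) (rule nu_letters)
  also have "\<dots> = b_sub m b 0 * f (nu m 0) + (\<Sum>i=1..m. b_sub m b i * f (nu m i))"
    by (simp add: sum.atLeast_Suc_atMost)
  also have "(\<Sum>i=1..m. b_sub m b i * f (nu m i)) = (\<Sum>i=1..m. (1 + b i) / 2 * f (nu m i))"
    by (rule sum.cong) (auto simp: b_sub_def add.commute)
  finally show ?thesis
    by (simp add: b_sub_def right_diff_distrib sum_subtractf sum_distrib_right left_diff_distrib
        add.commute)
qed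

text \<open>The interpolating form lies below \<open>f\<close>, and its expectation under each
  \<open>p\<close> equals that of \<open>f\<close> under the subvertex. The sign makes the lower
  bound an instance of \<open>dominates\<close>.\<close>

lemma subvertex_dominated:
  assumes f: "supermodular m f"
  shows "dominates m b (subvertex m b) (\<lambda>x. - f x)"
  unfolding dominates_def
proof
  fix p assume p: "p \<in> Pb m b"
  have "(\<Sum>x\<in>letters m. subvertex m b x * f x)
      = (\<Sum>x\<in>letters m. p x * affine_form m (f (nu m 0)) (\<lambda>i. f (nu m i) - f (nu m 0)) x)"
    unfolding sum_subvertex Pb_sum_affine_form[OF p] ..
  also have "\<dots> \<le> (\<Sum>x\<in>letters m. p x * f x)"
    by (intro sum_mono mult_left_mono supermodular_bounds f Pb_nonneg[OF p])
  finally show "(\<Sum>x\<in>letters m. p x * - f x) \<le> (\<Sum>x\<in>letters m. subvertex m b x * - f x)"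
    by (simp add: sum_negf)
qed

text \<open>For \<open>i \<ge> 1\<close> the letters \<open>nu m i\<close> and \<open>nu m 0\<close>
  differ at coordinate \<open>i\<close>, so one term survives. It lets the sign of
  \<open>b_sub m b 0\<close> be read off from the subvertex.\<close>

lemma subvertex_nu_0: "subvertex m b (nu m 0) = b_sub m b 0"
proof -
  have "basis_vec (nu m i) (nu m 0) = 0" if "i \<in> {1..m}" for i
    using that by (auto simp: basis_vec_def nu_def fun_eq_iff)
  then have "(\<Sum>i=1..m. b_sub m b i * basis_vec (nu m i) (nu m 0)) = 0"
    by (intro sum.neutral) auto
  then show ?thesis
    by (simp add: subvertex_def sum.atLeast_Suc_atMost basis_vec_def)
qed

text \<open>The subvertex has the prescribed mass and means, and \<open>b i \<ge> -1\<close> makes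
  its masses of positive index nonnegative. Membership thus reduces to the sign of
  \<open>b_sub m b 0\<close>, which is the stated inequality after division by
  \<open>m\<close>.\<close>

lemma subvertex_Pb_iff:
  assumes m: "1 \<le> m" and b: "\<forall>i\<in>{1..m}. b i \<in> {-1..1}"
  shows "subvertex m b \<in> Pb m b \<longleftrightarrow> 1 / real m * (\<Sum>i=1..m. b i) \<le> 2 / real m - 1"
proof -
  have b_sub_0: "b_sub m b 0 = 1 - ((\<Sum>i=1..m. b i) + real m) / 2"
    by (simp add: b_sub_def sum.distrib flip: sum_divide_distrib)
  have "0 \<le> b_sub m b 0 \<longleftrightarrow> (\<Sum>i=1..m. b i) \<le> 2 - real m"
    unfolding b_sub_0 by (auto simp: field_simps)
  also have "\<dots> \<longleftrightarrow> 1 / real m * (\<Sum>i=1..m. b i) \<le> 2 / real m - 1"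
    using m by (simp add: field_simps)
  finally have iff: "0 \<le> b_sub m b 0 \<longleftrightarrow> 1 / real m * (\<Sum>i=1..m. b i) \<le> 2 / real m - 1" .
  have inner: "inner_L m (ell j) (subvertex m b) = (if j = 0 then 1 else b j)" if "j \<le> m" for j
  proof -
    \<comment> \<open>Passing from \<open>nu m 0\<close> to \<open>nu m i\<close> changes
      \<open>ell j\<close> only for \<open>i = j\<close>, and then from -1 to 1.\<close>
    have "(\<Sum>i=1..m. (1 + b i) / 2 * (ell j (nu m i) - ell j (nu m 0)))
        = (\<Sum>i=1..m. if i = j then 1 + b i else 0)"
      by (rule sum.cong) (auto simp: ell_def nu_def)
    then show ?thesis
      using that unfolding inner_L_def
      by (subst mult.commute) (subst sum_subvertex, auto simp: ell_def nu_def)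
  qed
  have "0 \<le> b_sub m b 0 \<longleftrightarrow> subvertex m b \<in> Pb m b"
  proof
    assume b0: "0 \<le> b_sub m b 0"
    have "0 \<le> b_sub m b i" if "i \<in> {0..m}" for i
      using b0 bspec[OF b, of i] that by (cases "i = 0") (auto simp: b_sub_def)
    then have "0 \<le> subvertex m b x" for x
      unfolding subvertex_def by (intro sum_nonneg mult_nonneg_nonneg) (auto simp: basis_vec_def)
    then show "subvertex m b \<in> Pb m b"
      by (auto simp: Pb_def inner)
  next
    assume "subvertex m b \<in> Pb m b"
    then show "0 \<le> b_sub m b 0"
      using Pb_nonneg[of _ m b "nu m 0"] nu_letters subvertex_nu_0 by metis
  qed
  then show ?thesis using iff by simp
qed

section \<open>The supervertex\<close>

text \<open>Abel summation, written with \<open>1 + B i\<close> instead of \<open>B i\<close>: for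
  \<open>B 0 = 1\<close> and \<open>B (k + 1) = -1\<close> the first coefficient becomes 1 and the
  boundary term at \<open>k\<close> vanishes.\<close>

lemma sum_by_parts:
  fixes B g :: "nat \<Rightarrow> real"
  shows "(\<Sum>i=0..k. (B i - B (i + 1)) / 2 * g i)
    = (1 + B 0) / 2 * g 0 + (\<Sum>i=1..k. (1 + B i) / 2 * (g i - g (i - 1)))
        - (1 + B (k + 1)) / 2 * g k"
  by (induction k) (simp_all add: field_simps)

lemma sum_supervertex_decr:
  "(\<Sum>x\<in>letters m. supervertex_decr m b x * f x)
    = f (mu m 0) + (\<Sum>i=1..m. (1 + b i) / 2 * (f (mu m i) - f (mu m (i - 1))))"
proof -
  have "(\<Sum>x\<in>letters m. supervertex_decr m b x * f x)
      = (\<Sum>i=0..m. (b_ext m b i - b_ext m b (i + 1)) / 2 * f (mu m i))"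
    unfolding supervertex_decr_def by (rule sum_basis_vec) (rule mu_letters)
  also have "\<dots> = f (mu m 0) + (\<Sum>i=1..m. (1 + b_ext m b i) / 2 * (f (mu m i) - f (mu m (i - 1))))"
    by (subst sum_by_parts) (simp add: b_ext_def)
  also have "(\<Sum>i=1..m. (1 + b_ext m b i) / 2 * (f (mu m i) - f (mu m (i - 1))))
      = (\<Sum>i=1..m. (1 + b i) / 2 * (f (mu m i) - f (mu m (i - 1))))"
    by (rule sum.cong) (auto simp: b_ext_def)
  finally show ?thesis .
qed

lemma supervertex_decr_dominates:
  assumes f: "supermodular m f"
  shows "dominates m b (supervertex_decr m b) f"
  unfolding dominates_def
proof
  fix p assume p: "p \<in> Pb m b"
  have "(\<Sum>x\<in>letters m. p x * f x)
      \<le> (\<Sum>x\<in>letters m. p x * affine_form m (f (mu m 0)) (\<lambda>i. f (mu m i) - f (mu m (i - 1))) x)"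
    by (intro sum_mono mult_left_mono supermodular_bounds f Pb_nonneg[OF p])
  also have "\<dots> = (\<Sum>x\<in>letters m. supervertex_decr m b x * f x)"
    unfolding sum_supervertex_decr Pb_sum_affine_form[OF p] ..
  finally show "(\<Sum>x\<in>letters m. p x * f x) \<le> (\<Sum>x\<in>letters m. supervertex_decr m b x * f x)" .
qed

text \<open>Monotonicity and the bounds on \<open>b\<close> give nonnegative weights. Mass and means
  come from \<open>sum_supervertex_decr\<close> with \<open>f = ell j\<close>: for
  \<open>j \<ge> 1\<close> this function jumps by 2 at step \<open>j\<close> of the chain and
  nowhere else, and \<open>ell 0\<close> is constant on it.\<close>

lemma supervertex_decr_Pb:
  assumes b: "\<forall>i\<in>{1..m}. b i \<in> {-1..1}"
    and decr: "\<And>i j. i \<in> {1..m} \<Longrightarrow> j \<in> {1..m} \<Longrightarrow> i \<le> j \<Longrightarrow> b j \<le> b i"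
  shows "supervertex_decr m b \<in> Pb m b"
proof -
  have "b_ext m b (i + 1) \<le> b_ext m b i" if "i \<in> {0..m}" for i
    using that b decr[of i "i + 1"] by (auto simp: b_ext_def)
  then have "0 \<le> supervertex_decr m b x" for x
    unfolding supervertex_decr_def
    by (intro sum_nonneg mult_nonneg_nonneg) (auto simp: basis_vec_def)
  moreover have "inner_L m (ell j) (supervertex_decr m b) = (if j = 0 then 1 else b j)"
    if "j \<le> m" for j
  proof -
    have "(\<Sum>i=1..m. (1 + b i) / 2 * (ell j (mu m i) - ell j (mu m (i - 1))))
        = (\<Sum>i=1..m. if i = j then 1 + b i else 0)"
      by (rule sum.cong) (auto simp: ell_def mu_def)
    then show ?thesis
      using that unfolding inner_L_def
      by (subst mult.commute) (subst sum_supervertex_decr, auto simp: ell_def mu_def)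
  qed
  ultimately show ?thesis by (auto simp: Pb_def)
qed

section \<open>Permuting the coordinates\<close>

lemma letters_comp:
  assumes "\<sigma> permutes {1..m}" "x \<in> letters m"
  shows "x \<circ> \<sigma> \<in> letters m"
proof -
  have "\<sigma> i \<in> {1..m} \<longleftrightarrow> i \<in> {1..m}" for i
    using permutes_in_image[OF assms(1)] .
  then show ?thesis
    using assms(2) unfolding letters_def by (simp del: atLeastAtMost_iff)
qed

lemma comp_permutes_inv:
  assumes "\<sigma> permutes S"
  shows "(x \<circ> \<sigma>) \<circ> inv \<sigma> = x" "(x \<circ> inv \<sigma>) \<circ> \<sigma> = x"
  by (simp_all only: comp_assoc permutes_inv_o[OF assms] comp_id)

lemma sum_letters_comp:
  assumes "\<sigma> permutes {1..m}"
  shows "(\<Sum>x\<in>letters m. g (x \<circ> \<sigma>)) = (\<Sum>x\<in>letters m. g x)"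
  by (rule sum.reindex_bij_witness[of _ "\<lambda>x. x \<circ> inv \<sigma>" "\<lambda>x. x \<circ> \<sigma>"])
     (simp_all only: comp_permutes_inv[OF assms] letters_comp[OF assms]
       letters_comp[OF permutes_inv[OF assms]])

lemma sum_letters_comp_mult:
  assumes "\<sigma> permutes {1..m}"
  shows "(\<Sum>x\<in>letters m. p (x \<circ> \<sigma>) * f x) = (\<Sum>x\<in>letters m. p x * f (x \<circ> inv \<sigma>))"
  using sum_letters_comp[OF assms, of "\<lambda>x. p x * f (x \<circ> inv \<sigma>)"]
  by (simp only: comp_permutes_inv[OF assms])

text \<open>\<open>ell i (x \<circ> inv \<sigma>)\<close> is \<open>ell (inv \<sigma> i) x\<close>,
  so the means are permuted; coordinate 0 is fixed, which preserves the total mass.\<close>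

lemma Pb_comp:
  assumes \<sigma>: "\<sigma> permutes {1..m}" and p: "p \<in> Pb m b"
  shows "(\<lambda>x. p (x \<circ> \<sigma>)) \<in> Pb m (b \<circ> inv \<sigma>)"
proof -
  have "inner_L m (ell i) (\<lambda>x. p (x \<circ> \<sigma>)) = inner_L m (ell (inv \<sigma> i)) p" for i
    using sum_letters_comp_mult[OF \<sigma>, of p "ell i"] by (simp add: inner_L_def ell_def mult.commute)
  moreover have "inv \<sigma> 0 = 0"
    using permutes_not_in[OF permutes_inv[OF \<sigma>], of 0] by simp
  moreover have "inv \<sigma> i \<in> {1..m}" if "i \<in> {1..m}" for i
    using permutes_in_image[OF permutes_inv[OF \<sigma>]] that by blast
  ultimately show ?thesis
    using p letters_comp[OF \<sigma>] by (auto simp: Pb_def)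
qed

text \<open>Setting coordinate \<open>i\<close> before composing with \<open>\<sigma>\<close> sets
  coordinate \<open>inv \<sigma> i\<close> afterwards, and the pointwise order is respected.\<close>

lemma supermodular_comp:
  assumes \<sigma>: "\<sigma> permutes {1..m}" and f: "supermodular m f"
  shows "supermodular m (\<lambda>x. f (x \<circ> \<sigma>))"
proof -
  have upd: "y(i := c) \<circ> \<sigma> = (y \<circ> \<sigma>)(inv \<sigma> i := c)" for y :: letter and i c
    using permutes_inverses[OF \<sigma>] by (auto simp: fun_eq_iff)
  show ?thesis
    unfolding supermodular_def
  proof (intro ballI impI)
    fix y z i
    assume *: "y \<in> letters m" "z \<in> letters m" "i \<in> {1..m}" "\<forall>j. z j \<le> y j"
    have "y \<circ> \<sigma> \<in> letters m" "z \<circ> \<sigma> \<in> letters m"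
      using * letters_comp[OF \<sigma>] by auto
    moreover have "inv \<sigma> i \<in> {1..m}"
      using permutes_in_image[OF permutes_inv[OF \<sigma>]] *(3) by blast
    moreover have "\<forall>j. (z \<circ> \<sigma>) j \<le> (y \<circ> \<sigma>) j"
      using *(4) by simp
    ultimately show "f (y(i := 0) \<circ> \<sigma>) - f (y(i := 1) \<circ> \<sigma>)
        \<le> f (z(i := 0) \<circ> \<sigma>) - f (z(i := 1) \<circ> \<sigma>)"
      using f unfolding supermodular_def upd by blast
  qed
qed

text \<open>Reindexing the letters leaves expectations unchanged and carries \<open>P(b)\<close>
  into \<open>P(b \<circ> inv \<sigma>)\<close>, where the comparison is already known.\<close>

lemma dominates_comp:
  assumes \<sigma>: "\<sigma> permutes {1..m}"
    and dom: "dominates m (b \<circ> inv \<sigma>) q (\<lambda>x. f (x \<circ> \<sigma>))"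
  shows "dominates m b (\<lambda>x. q (x \<circ> inv \<sigma>)) f"
  unfolding dominates_def
proof
  fix p assume p: "p \<in> Pb m b"
  have "(\<Sum>x\<in>letters m. p x * f x) = (\<Sum>x\<in>letters m. p (x \<circ> \<sigma>) * f (x \<circ> \<sigma>))"
    by (rule sum_letters_comp[OF \<sigma>, symmetric])
  also have "\<dots> \<le> (\<Sum>x\<in>letters m. q x * f (x \<circ> \<sigma>))"
    using bspec[OF dom[unfolded dominates_def] Pb_comp[OF \<sigma> p]] by simp
  also have "\<dots> = (\<Sum>x\<in>letters m. q (x \<circ> inv \<sigma>) * f x)"
    using sum_letters_comp_mult[OF permutes_inv[OF \<sigma>], of q f] \<sigma> by (simp add: permutes_inv_inv)
  finally show "(\<Sum>x\<in>letters m. p x * f x) \<le> (\<Sum>x\<in>letters m. q (x \<circ> inv \<sigma>) * f x)" .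
qed

lemma sorting_perm_exists: "\<exists>\<sigma>. sorting_perm m b \<sigma>"
proof -
  \<comment> \<open>Sorting is ascending, so the negated key lists the indices by decreasing
    \<open>b\<close>.\<close>
  define xs where "xs = sort_key (\<lambda>i. - b i) [1..<m + 1]"
  \<comment> \<open>List positions start at 0, coordinates at 1; outside \<open>{1..m}\<close> a
    permutation of \<open>{1..m}\<close> is the identity.\<close>
  define \<tau> where "\<tau> i = (if i \<in> {1..m} then xs ! (i - 1) else i)" for i
  have len: "length xs = m" and xs: "set xs = {1..m}" "distinct xs"
    by (auto simp: xs_def)
  have "bij_betw (\<lambda>i. xs ! (i - 1)) {1..m} {1..m}"
  proof -
    have "bij_betw (\<lambda>i. i - 1) {1..m} {..<m}"
      by (rule bij_betw_byWitness[of _ Suc]) auto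
    moreover have "bij_betw ((!) xs) {..<m} {1..m}"
      by (rule bij_betw_nth) (auto simp: len xs)
    ultimately show ?thesis
      using bij_betw_trans by (fastforce simp: o_def)
  qed
  then have "bij_betw \<tau> {1..m} {1..m}"
    by (rule iffD1[OF bij_betw_cong, rotated]) (simp add: \<tau>_def)
  then have \<tau>: "\<tau> permutes {1..m}"
    by (rule bij_imp_permutes) (simp only: \<tau>_def if_False)
  have sorted: "sorted (map (\<lambda>i. - b i) xs)"
    unfolding xs_def by (rule sorted_sort_key)
  have "b (\<tau> j) \<le> b (\<tau> i)" if "i \<in> {1..m}" "j \<in> {1..m}" "i \<le> j" for i j
    using sorted_nth_mono[OF sorted, of "i - 1" "j - 1"] that len by (auto simp: \<tau>_def)
  \<comment> \<open>\<open>sorting_perm\<close> composes \<open>b\<close> with the inverse, hence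
    the witness \<open>inv \<tau>\<close>.\<close>
  then have "sorting_perm m b (inv \<tau>)"
    using \<tau> by (simp add: sorting_perm_def permutes_inv permutes_inv_inv)
  then show ?thesis by blast
qed

text \<open>\<open>SOME\<close> picks one of possibly several sorting permutations; it is accessible
  only through the property of sorting \<open>b\<close>.\<close>

lemma supervertex_obtain:
  obtains \<sigma> where "sorting_perm m b \<sigma>"
    "supervertex m b = (\<lambda>x. supervertex_decr m (b \<circ> inv \<sigma>) (x \<circ> inv \<sigma>))"
  using someI_ex[OF sorting_perm_exists[of m b]] by (auto simp: supervertex_def Let_def)

lemma supervertex_dominates:
  assumes "supermodular m f"
  shows "dominates m b (supervertex m b) f"
proof -
  obtain \<sigma> where \<sigma>: "sorting_perm m b \<sigma>"
    and eq: "supervertex m b = (\<lambda>x. supervertex_decr m (b \<circ> inv \<sigma>) (x \<circ> inv \<sigma>))"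
    by (rule supervertex_obtain)
  have perm: "\<sigma> permutes {1..m}"
    using \<sigma> by (simp add: sorting_perm_def)
  show ?thesis
    unfolding eq
    by (intro dominates_comp perm supervertex_decr_dominates supermodular_comp assms)
qed

lemma supervertex_Pb:
  assumes b: "\<forall>i\<in>{1..m}. b i \<in> {-1..1}"
  shows "supervertex m b \<in> Pb m b"
proof -
  obtain \<sigma> where \<sigma>: "sorting_perm m b \<sigma>"
    and eq: "supervertex m b = (\<lambda>x. supervertex_decr m (b \<circ> inv \<sigma>) (x \<circ> inv \<sigma>))"
    by (rule supervertex_obtain)
  have perm: "\<sigma> permutes {1..m}"
    using \<sigma> by (simp add: sorting_perm_def)
  have "\<forall>i\<in>{1..m}. (b \<circ> inv \<sigma>) i \<in> {-1..1}"
    using b permutes_in_image[OF permutes_inv[OF perm]] by fastforce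
  then have "supervertex_decr m (b \<circ> inv \<sigma>) \<in> Pb m (b \<circ> inv \<sigma>)"
    using \<sigma> by (intro supervertex_decr_Pb) (auto simp: sorting_perm_def)
  \<comment> \<open>Composing with \<open>inv \<sigma>\<close> undoes the rearrangement of the
    means.\<close>
  from Pb_comp[OF permutes_inv[OF perm] this]
  show ?thesis
    by (simp only: eq permutes_inv_inv[OF perm] comp_permutes_inv[OF perm])
qed

section \<open>Extremal expectations over words\<close>

theorem theorem1p10:
  fixes m n :: nat and b :: "nat \<Rightarrow> real" and F :: "letter list \<Rightarrow> real"
  assumes "1 \<le> m" and "1 \<le> n"
    and "\<forall>i\<in>{1..m}. b i \<in> {-1..1}"
    and "truncated_lpos m n F"
  shows
    "(\<forall>P\<in>Gam m n b. \<forall>k\<le>n. \<forall>\<omega>\<in>words m (n - k). 0 < prob_of P (cylinder m k \<omega>) \<longrightarrow>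
        cond_expect P F (cylinder m k \<omega>) \<le> expect_iid m k (supervertex m b) (after F \<omega>)) \<and>
     is_maximum (expect_iid m n (supervertex m b) F) ((\<lambda>P. expect m n P F) ` Gam m n b) \<and>
     (subvertex m b \<in> Pb m b \<longleftrightarrow> 1 / real m * (\<Sum>i=1..m. b i) \<le> 2 / real m - 1) \<and>
     (subvertex m b \<in> Pb m b \<longrightarrow>
       (\<forall>P\<in>Gam m n b. \<forall>k\<le>n. \<forall>\<omega>\<in>words m (n - k). 0 < prob_of P (cylinder m k \<omega>) \<longrightarrow>
          expect_iid m k (subvertex m b) (after F \<omega>) \<le> cond_expect P F (cylinder m k \<omega>)) \<and>
       is_minimum (expect_iid m n (subvertex m b) F) ((\<lambda>P. expect m n P F) ` Gam m n b))"
proof -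
  have sm: "supermodular m (\<lambda>x. F (w @ [x] @ t))"
    if "set w \<subseteq> letters m" "set t \<subseteq> letters m" "length w + length t + 1 = n" for w t
    using assms(4) that by (intro U_lpos_plus_supermodular) (simp add: truncated_lpos_def)
  have sup_dom: "dominates m b (supervertex m b) (\<lambda>x. F (w @ [x] @ t))"
    and sub_dom: "dominates m b (subvertex m b) (\<lambda>x. - F (w @ [x] @ t))"
    if "set w \<subseteq> letters m" "set t \<subseteq> letters m" "length w + length t + 1 = n" for w t
    using sm[OF that] by (rule supervertex_dominates, rule subvertex_dominated)
  have sup: "supervertex m b \<in> Pb m b"
    using assms(3) by (rule supervertex_Pb)
  have upper: "cond_expect P F (cylinder m k w) \<le> expect_iid m k (supervertex m b) (after F w)"
    if "P \<in> Gam m n b" "k \<le> n" "w \<in> words m (n - k)" "0 < prob_of P (cylinder m k w)" for P k w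
    by (rule cond_expect_le_iid[OF that(1) Pb_nonneg[OF sup] sup_dom that(2-4)])
  have max: "is_maximum (expect_iid m n (supervertex m b) F) ((\<lambda>P. expect m n P F) ` Gam m n b)"
    by (intro is_maximum_expect_iid sup sup_dom)
  \<comment> \<open>The upper estimate for \<open>- F\<close>; membership in \<open>P(b)\<close>
    provides the nonnegative weights that it requires.\<close>
  have lower: "expect_iid m k (subvertex m b) (after F w) \<le> cond_expect P F (cylinder m k w)"
    if sub: "subvertex m b \<in> Pb m b"
      and "P \<in> Gam m n b" "k \<le> n" "w \<in> words m (n - k)" "0 < prob_of P (cylinder m k w)" for P k w
  proof -
    have "cond_expect P (\<lambda>w. - F w) (cylinder m k w)
        \<le> expect_iid m k (subvertex m b) (after (\<lambda>w. - F w) w)"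
      by (rule cond_expect_le_iid[OF that(2) Pb_nonneg[OF sub] sub_dom that(3-5)])
    moreover have "after (\<lambda>w. - F w) w = (\<lambda>t. - after F w t)"
      by (simp add: after_def fun_eq_iff)
    ultimately show ?thesis
      by (simp add: cond_expect_uminus expect_iid_uminus)
  qed
  \<comment> \<open>Membership also puts the product density of the subvertex into
    \<open>Gam m n b\<close>, so the bound is attained.\<close>
  have min: "is_minimum (expect_iid m n (subvertex m b) F) ((\<lambda>P. expect m n P F) ` Gam m n b)"
    if sub: "subvertex m b \<in> Pb m b"
  proof -
    have "is_maximum (expect_iid m n (subvertex m b) (\<lambda>w. - F w))
        ((\<lambda>P. expect m n P (\<lambda>w. - F w)) ` Gam m n b)"
      by (intro is_maximum_expect_iid sub sub_dom)
    then show ?thesis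
      by (simp add: expect_uminus expect_iid_uminus is_maximum_uminus)
  qed
  show ?thesis
    using upper max lower min subvertex_Pb_iff[OF assms(1,3)] by blast
qed

end
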